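(* Let $N\ge1$ be arbitrary. If an FT$N$S system is first order symmetric hyperbolic (i.e. it has a direct first order reduction admitting a positive definite first order candidate symmetrizer), then it is FT$N$S symmetric hyperbolic (i.e. it admits a positive definite FT$N$S candidate symmetrizer).
   Context: Space is $\mathbb{R}^3$ with coordinates $x^i$, $i=1,2,3$, and Euclidean metric; repeated spatial indices are summed; $(\dots)$ around indices denotes symmetrization with total weight one. All coefficient matrices are constant and complex. Underlined indices $\underline{i}$ stand for the appropriate number of spatial indices. **FT$N$S systems.** The unknowns are vectors of fields $v^0,\dots,v^{N-1}$, $v^\mu$ having $n_\mu$ components, depending on $t$ and $x$. The equations are, for $\mu=0,\dots,N-1$, $$\partial_t v^\mu=\sum_{\nu=0}^{\min(\mu+1,N-1)}(A^\mu{}_\nu)^{i_1\dots i_{\mu-\nu+1}}\partial_{i_1}\cdots\partial_{i_{\mu-\nu+1}}v^\nu+\sum_{\nu=0}^{\mu}\sum_{\rho=1}^{\mu-\nu+1}(B^\mu{}_{\rho\,\nu})^{i_1\dots i_{\mu-\nu-\rho+1}}\partial_{i_1}\cdots\partial_{i_{\mu-\nu-\rho+1}}v^\nu+s^\mu$$ (with zero indices the terms are multiplication by a matrix), with given source terms $s^\mu$ independent of the fields. **Principal matrix.** $\mathcal A_N{}^p{}_{\underline i}{}^{\underline j}$ is the block matrix with blocks $\mu,\nu=0,\dots,N-1$, where the $(\mu,\nu)$ block carries lower indices $i_1\dots i_{N-\mu-1}$ and upper indices $p\,j_1\dots j_{N-\nu-1}$ and equals $(\Delta^N_{\mu\nu})^{p(\underline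 j)}_{(\underline i)\underline k}(A^\mu{}_\nu)^{\underline k}$ for $\nu\le\mu+1$ and $0$ for $\nu>\mu+1$. Here, writing the $N-\nu$ upper indices $(p,j_1,\dots,j_{N-\nu-1})$ as $(l_1,\dots,l_{N-\nu})$, $\Delta^N_{\mu\nu}=\delta^{l_1}_{i_1}\cdots\delta^{l_{N-\mu-1}}_{i_{N-\mu-1}}\delta^{l_{N-\mu}}_{k_1}\cdots\delta^{l_{N-\nu}}_{k_{\mu-\nu+1}}$ (with the $\delta_i$ factors absent if $\mu=N-1$ and the $\delta_k$ factors absent if $\nu=\mu+1$). **FT$N$S symmetrizers.** For a vector $s\in\mathbb{R}^3$ let $S^N_{\underline j}=\mathrm{diag}(s_{j_1}\cdots s_{j_{N-1}},\,s_{j_1}\cdots s_{j_{N-2}},\dots,s_{j_1},1)$, block $\mu$ carrying $N-\mu-1$ indices. An FT$N$S candidate symmetrizer is a Hermitian matrix $H_N^{\underline i\,\underline j}=H_N^{(\underline i)\,(\underline j)}$, that is, a Hermitian form on the space of tuples $(w^\mu_{i_1\dots i_{N-\mu-1}})_{\mu=0}^{N-1}$ with $w^\mu$ a $\mathbb{C}^{n_\mu}$-valued totally symmetric tensor, such that the matrix $S^N_{\underline i}H_N^{\underline i\,\underline k}\mathcal A_N{}^p{}_{\underline k}{}^{\underline j}s_pS^N_{\underline j}$ (acting on $\mathbb{C}^{n_0}\oplus\dots\oplus\mathbb{C}^{n_{N-1}}$) is Hermitian for every $s$. The system is FT$N$S symmetric hyperbolic if there is an FT$N$S candidate symmetrizer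 that is positive definite on this space of symmetric tensors. **Direct first order reductions.** For $\mu=0,\dots,N-2$ and $\nu=1,\dots,N-\mu-1$ introduce variables $(d^\mu_\nu)_{i_1\dots i_\nu}$, $\mathbb{C}^{n_\mu}$-valued and totally symmetric in the indices, replacing $\partial_{i_1}\cdots\partial_{i_\nu}v^\mu$. Write $d^\mu_0:=v^\mu$ for all $\mu$, $d^\mu:=d^\mu_{N-\mu-1}$ for $\mu\le N-2$ and $d^{N-1}:=v^{N-1}$. The auxiliary constraints are, for $\nu=0,\dots,N-2$, $\sigma=1,\dots,N-\nu-1$, $$(c^\nu_\sigma)_{i_1\dots i_\sigma}=\partial_{(i_1}(d^\nu_{\sigma-1})_{i_2\dots i_\sigma)}-(d^\nu_\sigma)_{i_1\dots i_\sigma},\qquad(\bar c^\nu_\sigma)_{i_1\dots i_{\sigma+1}}=\partial_{i_1}(d^\nu_\sigma)_{i_2\dots i_{\sigma+1}}-\partial_{(i_1}(d^\nu_\sigma)_{i_2\dots i_{\sigma+1})}.$$ To each evolution equation, labelled by $X$ (either $X=\mu$ for $v^\mu$, or $X=(\mu,\lambda,i_1,\dots,i_\lambda)$ for $(d^\mu_\lambda)_{i_1\dots i_\lambda}$), one adds $$C^X=\sum_{\nu=0}^{N-2}\sum_{\sigma=1}^{N-\nu-1}\Big[(D^{X\,\sigma}{}_\nu)^{i_1\dots i_\sigma}(c^\nu_\sigma)_{i_1\dots i_\sigma}+(\bar D^{X\,\sigma}{}_\nu)^{i_1\dots i_{\sigma+1}}(\bar c^\nu_\sigma)_{i_1\dots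 i_{\sigma+1}}\Big],$$ with arbitrary constant matrices $D,\bar D$ (the reduction parameters), independent for different equations (symmetric in $i_1\dots i_\lambda$ of $X$), subject to: $D^{X\,\sigma}{}_\nu$ is totally symmetric in its upper indices, $(\bar D^{X\,\sigma}{}_\nu)^{(i_1\dots i_{\sigma+1})}=0$, and $(\bar D^{X\,\sigma}{}_\nu)^{i_1i_2\dots i_{\sigma+1}}=(\bar D^{X\,\sigma}{}_\nu)^{i_1(i_2\dots i_{\sigma+1})}$. A first order reduction is a system of the following form. For $0\le\mu\le N-2$, $0\le\sigma\le N-\mu-2$ (with $\sigma=0$ giving the equation for $v^\mu$): $$\partial_t(d^\mu_\sigma)_{\underline i}=\sum_{\nu=0}^{\mu+1}(A^\mu{}_\nu)^{\underline j}(d^\nu_{\mu+\sigma-\nu+1})_{\underline i\,\underline j}+\sum_{\nu=0}^{\mu}\sum_{\rho=1}^{\mu-\nu+1}(B^\mu{}_{\rho\,\nu})^{\underline j}(d^\nu_{\mu+\sigma-\nu-\rho+1})_{\underline i\,\underline j}+\partial_{i_1}\cdots\partial_{i_\sigma}s^\mu+C^X.$$ For $0\le\mu\le N-2$, with $\underline i=i_1\dots i_{N-\mu-1}$ and total symmetrization over all indices of $\partial$ and $d^\nu$: $$\partial_t(d^\mu)_{\underline i}=\sum_{\nu=0}^{\mu+1}(A^\mu{}_\nu)^{\underline j}\,\partial_{(i_1}(d^\nu)_{i_2\dots i_{N-\mu-1}\underline j)}+\sum_{\nu=0}^{\mu}\sum_{\rho=1}^{\mu-\nu+1}(B^\mu{}_{\rho\,\nu})^{\underline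 j}(d^\nu_{N-\nu-\rho})_{\underline i\,\underline j}+\partial_{i_1}\cdots\partial_{i_{N-\mu-1}}s^\mu+C^X.$$ Finally $$\partial_tv^{N-1}=\sum_{\nu=0}^{N-1}(A^{N-1}{}_\nu)^{j\underline i}\partial_j(d^\nu)_{\underline i}+\sum_{\nu=0}^{N-1}\sum_{\rho=1}^{N-\nu}(B^{N-1}{}_{\rho\,\nu})^{\underline j}(d^\nu_{N-\nu-\rho})_{\underline j}+s^{N-1}+C^{N-1}.$$ (For $N=1$ there are no new variables or constraints and the only reduction is the system itself.) With $u$ the vector of all variables $d^\mu_\nu$ ($0\le\mu\le N-1$, $0\le\nu\le N-\mu-1$), keeping only the terms with first derivatives of the variables gives the principal part $\partial_tu_{\underline i}\simeq\mathcal A_1{}^p{}_{\underline i}{}^{\underline j}\partial_pu_{\underline j}$, which defines $\mathcal A_1{}^p$ as linear maps on the space of values of $u$ (tuples of totally symmetric tensors). **First order symmetrizers.** A Hermitian matrix $H_1^{\underline i\,\underline j}=H_1^{(\underline i)\,(\underline j)}$ (a Hermitian form on the space of values of $u$) is a first order candidate symmetrizer of the FT$N$S system if there is a first order reduction (choice of $D,\bar D$) such that $H_1^{\underline i\,\underline k}\mathcal A_1{}^p{}_{\underline k}{}^{\underline j}s_p$ is Hermitian for every $s\in\mathbb{R}^3$. The system is first order symmetric hyperbolic if there is a first order candidate symmetrizer that is positive definite on the space of symmetric tensors. *)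

theory Defs
  imports "HOL-Analysis.Analysis" "HOL-Combinatorics.Combinatorics"
begin

text \<open>
  Spatial indices are elements of the three-element type \<open>3\<close>, and a multi-index
  \<open>i\<^sub>1 \<dots> i\<^sub>k\<close> is the list \<open>[i\<^sub>1, \<dots>, i\<^sub>k]\<close>.  Components of vectors in \<open>\<complex>\<^sup>n\<close> are numbered
  \<open>0, \<dots>, n - 1\<close>.
\<close>

type_synonym mindex = "3 list"

definition mindices :: "nat \<Rightarrow> mindex set" where
  "mindices k = {ks. length ks = k}"

text \<open>Symmetrization (total weight one), over permutations of the index positions.\<close>

definition symz :: "(mindex \<Rightarrow> complex) \<Rightarrow> mindex \<Rightarrow> complex" where
  "symz f ks = (\<Sum>\<pi> | \<pi> permutes {..<length ks}. f (permute_list \<pi> ks)) / fact (length ks)"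

text \<open>
  The data of an FT\<open>N\<close>S system with \<open>N = ft_order\<close> and \<open>n\<^sub>\<mu> = ft_dim \<mu>\<close>:
  \<open>ft_A \<mu> \<nu> ks a b\<close> is the \<open>(a, b)\<close> entry of \<open>(A\<^sup>\<mu>\<^sub>\<nu>)\<close> with upper indices \<open>ks\<close>,
  \<open>ft_B \<mu> \<rho> \<nu> ks a b\<close> that of \<open>(B\<^sup>\<mu>\<^sub>\<rho>\<^sub>\<nu>)\<close>, and \<open>ft_src \<mu> a t x\<close> is the component \<open>a\<close> of \<open>s\<^sup>\<mu>\<close>.
  Only entries with \<open>\<nu> \<le> \<mu> + 1\<close>, \<open>length ks = \<mu> + 1 - \<nu>\<close> (respectively
  \<open>\<nu> \<le> \<mu>\<close>, \<open>1 \<le> \<rho> \<le> \<mu> + 1 - \<nu>\<close>, \<open>length ks = \<mu> + 1 - \<nu> - \<rho>\<close>) are ever used.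
\<close>

record ftns_system =
  ft_order :: nat
  ft_dim :: "nat \<Rightarrow> nat"
  ft_A :: "nat \<Rightarrow> nat \<Rightarrow> mindex \<Rightarrow> nat \<Rightarrow> nat \<Rightarrow> complex"
  ft_B :: "nat \<Rightarrow> nat \<Rightarrow> nat \<Rightarrow> mindex \<Rightarrow> nat \<Rightarrow> nat \<Rightarrow> complex"
  ft_src :: "nat \<Rightarrow> nat \<Rightarrow> real \<Rightarrow> real ^ 3 \<Rightarrow> complex"

fun partials :: "mindex \<Rightarrow> (real ^ 3 \<Rightarrow> complex) \<Rightarrow> real ^ 3 \<Rightarrow> complex" where
  "partials [] f x = f x"
| "partials (i # ks) f x = frechet_derivative (partials ks f) (at x) (axis i 1)"

text \<open>The right-hand side of the evolution equation for component \<open>a\<close> of \<open>v\<^sup>\<mu>\<close>.\<close>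

definition ftns_rhs ::
  "ftns_system \<Rightarrow> (nat \<Rightarrow> nat \<Rightarrow> real \<Rightarrow> real ^ 3 \<Rightarrow> complex) \<Rightarrow> real \<Rightarrow> real ^ 3 \<Rightarrow> nat \<Rightarrow> nat \<Rightarrow> complex" where
  "ftns_rhs S v t x \<mu> a =
     (\<Sum>\<nu>=0..min (\<mu> + 1) (ft_order S - 1). \<Sum>ks\<in>mindices (\<mu> + 1 - \<nu>). \<Sum>b<ft_dim S \<nu>.
        ft_A S \<mu> \<nu> ks a b * partials ks (v \<nu> b t) x)
   + (\<Sum>\<nu>=0..\<mu>. \<Sum>\<rho>=1..\<mu> + 1 - \<nu>. \<Sum>ks\<in>mindices (\<mu> + 1 - \<nu> - \<rho>). \<Sum>b<ft_dim S \<nu>.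
        ft_B S \<mu> \<rho> \<nu> ks a b * partials ks (v \<nu> b t) x)
   + ft_src S \<mu> a t x"

text \<open>
  The triple \<open>(\<mu>, is, a)\<close> labels the component \<open>a\<close> of \<open>(d\<^sup>\<mu>\<^sub>\<sigma>)\<close> with indices \<open>is\<close>, where
  \<open>\<sigma> = length is\<close>; so \<open>(\<mu>, [], a)\<close> is a component of \<open>v\<^sup>\<mu>\<close>.  A state assigns values to these labels;
  only labels in the relevant index set matter.
\<close>

type_synonym label = "nat \<times> mindex \<times> nat"
type_synonym state = "label \<Rightarrow> complex"

definition top_labels :: "ftns_system \<Rightarrow> label set" where
  "top_labels S = {(\<mu>, is, a). \<mu> < ft_order S \<and> length is = ft_order S - \<mu> - 1 \<and> a < ft_dim S \<mu>}"

definition all_labels :: "ftns_system \<Rightarrow> label set" where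
  "all_labels S = {(\<mu>, is, a). \<mu> < ft_order S \<and> length is \<le> ft_order S - \<mu> - 1 \<and> a < ft_dim S \<mu>}"

definition symmetric_state :: "label set \<Rightarrow> state \<Rightarrow> bool" where
  "symmetric_state L w \<longleftrightarrow>
     (\<forall>\<mu> is js a. (\<mu>, is, a) \<in> L \<and> mset is = mset js \<longrightarrow> w (\<mu>, is, a) = w (\<mu>, js, a))"

definition hermitian_on :: "'a set \<Rightarrow> ('a \<Rightarrow> 'a \<Rightarrow> complex) \<Rightarrow> bool" where
  "hermitian_on L M \<longleftrightarrow> (\<forall>x\<in>L. \<forall>y\<in>L. M x y = cnj (M y x))"

text \<open>Hermitian matrices with \<open>H\<^sup>i\<^sup>j = H\<^sup>(\<^sup>i\<^sup>)\<^sup>(\<^sup>j\<^sup>)\<close>; symmetry in \<open>j\<close> follows from Hermiticity.\<close>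

definition symmetric_hermitian :: "label set \<Rightarrow> (label \<Rightarrow> label \<Rightarrow> complex) \<Rightarrow> bool" where
  "symmetric_hermitian L H \<longleftrightarrow>
     hermitian_on L H \<and> (\<forall>y\<in>L. symmetric_state L (\<lambda>x. H x y))"

definition form :: "label set \<Rightarrow> (label \<Rightarrow> label \<Rightarrow> complex) \<Rightarrow> state \<Rightarrow> state \<Rightarrow> complex" where
  "form L H w z = (\<Sum>x\<in>L. \<Sum>y\<in>L. cnj (w x) * H x y * z y)"

text \<open>For a Hermitian matrix the value \<open>form L H w w\<close> is real.\<close>

definition positive_definite :: "label set \<Rightarrow> (label \<Rightarrow> label \<Rightarrow> complex) \<Rightarrow> bool" where
  "positive_definite L H \<longleftrightarrow>
     (\<forall>w. symmetric_state L w \<and> (\<exists>x\<in>L. w x \<noteq> 0) \<longrightarrow> Re (form L H w w) > 0)"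


subsection \<open>FTNS symmetric hyperbolicity\<close>

text \<open>
  The product of Kronecker symbols \<open>\<Delta>\<^sup>N\<^sub>\<mu>\<^sub>\<nu>\<close> is one if the list of the \<open>l\<close> indices is the list of the
  \<open>i\<close> indices followed by the list of the \<open>k\<close> indices, and zero otherwise.  It is symmetrized
  over \<open>is\<close> and over \<open>js\<close>, where \<open>ls = p # js\<close>.
\<close>

definition Delta :: "mindex \<Rightarrow> mindex \<Rightarrow> mindex \<Rightarrow> complex" where
  "Delta ls is ks = (if ls = is @ ks then 1 else 0)"

definition principal_matrix :: "ftns_system \<Rightarrow> 3 \<Rightarrow> label \<Rightarrow> label \<Rightarrow> complex" where
  "principal_matrix S p = (\<lambda>(\<mu>, is, a) (\<nu>, js, b).
     if \<nu> \<le> \<mu> + 1 then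
       (\<Sum>ks\<in>mindices (\<mu> + 1 - \<nu>).
          symz (\<lambda>is'. symz (\<lambda>js'. Delta (p # js') is' ks) js) is * ft_A S \<mu> \<nu> ks a b)
     else 0)"

definition monom_of :: "real ^ 3 \<Rightarrow> mindex \<Rightarrow> complex" where
  "monom_of s ks = (\<Prod>k\<leftarrow>ks. complex_of_real (s $ k))"

text \<open>The entry \<open>((\<mu>, a), (\<nu>, b))\<close> of the matrix \<open>S\<^sub>i H\<^sup>i\<^sup>k A\<^sup>p\<^sub>k\<^sup>j s\<^sub>p S\<^sub>j\<close> on \<open>\<complex>\<^sup>n\<^sup>0 \<oplus> \<dots> \<oplus> \<complex>\<^sup>n\<^sup>N\<^sup>-\<^sup>1\<close>.\<close>

definition contracted_matrix ::
  "ftns_system \<Rightarrow> (label \<Rightarrow> label \<Rightarrow> complex) \<Rightarrow> real ^ 3 \<Rightarrow> nat \<times> nat \<Rightarrow> nat \<times> nat \<Rightarrow> complex" where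
  "contracted_matrix S H s = (\<lambda>(\<mu>, a) (\<nu>, b).
     \<Sum>is\<in>mindices (ft_order S - \<mu> - 1). \<Sum>js\<in>mindices (ft_order S - \<nu> - 1).
       \<Sum>y\<in>top_labels S. \<Sum>p\<in>UNIV.
         monom_of s is * H (\<mu>, is, a) y * principal_matrix S p y (\<nu>, js, b)
           * complex_of_real (s $ p) * monom_of s js)"

definition ftns_candidate_symmetrizer :: "ftns_system \<Rightarrow> (label \<Rightarrow> label \<Rightarrow> complex) \<Rightarrow> bool" where
  "ftns_candidate_symmetrizer S H \<longleftrightarrow>
     symmetric_hermitian (top_labels S) H \<and>
     (\<forall>s. hermitian_on {(\<mu>, a). \<mu> < ft_order S \<and> a < ft_dim S \<mu>} (contracted_matrix S H s))"

definition ftns_symmetric_hyperbolic :: "ftns_system \<Rightarrow> bool" where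
  "ftns_symmetric_hyperbolic S \<longleftrightarrow>
     (\<exists>H. ftns_candidate_symmetrizer S H \<and> positive_definite (top_labels S) H)"


subsection \<open>Direct first order reductions\<close>

text \<open>
  Below, \<open>U\<close> stands for the value of \<open>u\<close> at a point, and \<open>P i\<close> for the value there of \<open>\<partial>\<^sub>i u\<close>.  The
  auxiliary constraint \<open>c\<^sup>\<nu>\<^sub>\<sigma>\<close> and its barred version carry \<open>\<sigma>\<close> and \<open>\<sigma> + 1\<close> indices \<open>ks\<close>, respectively.
\<close>

definition constr :: "state \<Rightarrow> (3 \<Rightarrow> state) \<Rightarrow> label \<Rightarrow> complex" where
  "constr U P = (\<lambda>(\<nu>, ks, b). symz (\<lambda>ls. P (hd ls) (\<nu>, tl ls, b)) ks - U (\<nu>, ks, b))"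

definition constr_bar :: "(3 \<Rightarrow> state) \<Rightarrow> label \<Rightarrow> complex" where
  "constr_bar P = (\<lambda>(\<nu>, ks, b).
     P (hd ks) (\<nu>, tl ks, b) - symz (\<lambda>ls. P (hd ls) (\<nu>, tl ls, b)) ks)"

text \<open>
  Reduction parameters: \<open>D X (\<nu>, ks, b)\<close> is the entry of \<open>D\<^sup>X\<^sup>\<sigma>\<^sub>\<nu>\<close> with upper indices \<open>ks\<close>,
  \<open>\<sigma> = length ks\<close>, and column \<open>b\<close>, the row being the last entry of the label \<open>X\<close>.  Likewise
  \<open>E X (\<nu>, ks, b)\<close> for the barred parameters, with \<open>\<sigma> + 1 = length ks\<close>.
\<close>

definition reduction_parameters ::
  "ftns_system \<Rightarrow> (label \<Rightarrow> label \<Rightarrow> complex) \<Rightarrow> (label \<Rightarrow> label \<Rightarrow> complex) \<Rightarrow> bool" where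
  "reduction_parameters S D E \<longleftrightarrow>
     (\<forall>\<nu> \<sigma> b. \<nu> < ft_order S - 1 \<and> \<sigma> \<in> {1..ft_order S - \<nu> - 1} \<and> b < ft_dim S \<nu> \<longrightarrow>
        (\<forall>ks\<in>mindices \<sigma>. symmetric_state (all_labels S) (\<lambda>X. D X (\<nu>, ks, b))) \<and>
        (\<forall>ks\<in>mindices (\<sigma> + 1). symmetric_state (all_labels S) (\<lambda>X. E X (\<nu>, ks, b))) \<and>
        (\<forall>X\<in>all_labels S.
           (\<forall>ks\<in>mindices \<sigma>. \<forall>ls. mset ks = mset ls \<longrightarrow> D X (\<nu>, ks, b) = D X (\<nu>, ls, b)) \<and>
           (\<forall>ks\<in>mindices (\<sigma> + 1). symz (\<lambda>ls. E X (\<nu>, ls, b)) ks = 0) \<and>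
           (\<forall>i. \<forall>ks\<in>mindices \<sigma>. \<forall>ls. mset ks = mset ls \<longrightarrow>
              E X (\<nu>, i # ks, b) = E X (\<nu>, i # ls, b))))"

definition constraint_addition ::
  "ftns_system \<Rightarrow> (label \<Rightarrow> label \<Rightarrow> complex) \<Rightarrow> (label \<Rightarrow> label \<Rightarrow> complex) \<Rightarrow>
     state \<Rightarrow> (3 \<Rightarrow> state) \<Rightarrow> label \<Rightarrow> complex" where
  "constraint_addition S D E U P X =
     (\<Sum>\<nu><ft_order S - 1. \<Sum>\<sigma>=1..ft_order S - \<nu> - 1.
        (\<Sum>ks\<in>mindices \<sigma>. \<Sum>b<ft_dim S \<nu>. D X (\<nu>, ks, b) * constr U P (\<nu>, ks, b))
      + (\<Sum>ks\<in>mindices (\<sigma> + 1). \<Sum>b<ft_dim S \<nu>. E X (\<nu>, ks, b) * constr_bar P (\<nu>, ks, b)))"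

text \<open>
  The three cases of the first summand are the equations for \<open>(d\<^sup>\<mu>\<^sub>\<sigma>)\<close> with \<open>\<sigma> \<le> N - \<mu> - 2\<close>,
  for \<open>d\<^sup>\<mu>\<close> with \<open>\<mu> \<le> N - 2\<close>, and for \<open>v\<^sup>N\<^sup>-\<^sup>1\<close>.
\<close>

definition reduction_rhs ::
  "ftns_system \<Rightarrow> (label \<Rightarrow> label \<Rightarrow> complex) \<Rightarrow> (label \<Rightarrow> label \<Rightarrow> complex) \<Rightarrow>
     real \<Rightarrow> real ^ 3 \<Rightarrow> state \<Rightarrow> (3 \<Rightarrow> state) \<Rightarrow> label \<Rightarrow> complex" where
  "reduction_rhs S D E t x U P = (\<lambda>(\<mu>, is, a).
     (if length is < ft_order S - \<mu> - 1 then
        (\<Sum>\<nu>=0..\<mu> + 1. \<Sum>js\<in>mindices (\<mu> + 1 - \<nu>). \<Sum>b<ft_dim S \<nu>.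
           ft_A S \<mu> \<nu> js a b * U (\<nu>, is @ js, b))
      else if \<mu> < ft_order S - 1 then
        (\<Sum>\<nu>=0..\<mu> + 1. \<Sum>js\<in>mindices (\<mu> + 1 - \<nu>). \<Sum>b<ft_dim S \<nu>.
           ft_A S \<mu> \<nu> js a b * symz (\<lambda>ls. P (hd ls) (\<nu>, tl ls, b)) (is @ js))
      else
        (\<Sum>\<nu>=0..\<mu>. \<Sum>j\<in>UNIV. \<Sum>js\<in>mindices (\<mu> - \<nu>). \<Sum>b<ft_dim S \<nu>.
           ft_A S \<mu> \<nu> (j # js) a b * P j (\<nu>, js, b)))
   + (\<Sum>\<nu>=0..\<mu>. \<Sum>\<rho>=1..\<mu> + 1 - \<nu>. \<Sum>js\<in>mindices (\<mu> + 1 - \<nu> - \<rho>). \<Sum>b<ft_dim S \<nu>.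
        ft_B S \<mu> \<rho> \<nu> js a b * U (\<nu>, is @ js, b))
   + partials is (ft_src S \<mu> a t) x
   + constraint_addition S D E U P (\<mu>, is, a))"

text \<open>
  The right-hand side is the sum of a linear function of \<open>P\<close>, a linear function of \<open>U\<close>, and a
  source, so its increment from \<open>P = 0\<close> consists of the terms with first derivatives, whatever
  the values of \<open>t\<close>, \<open>x\<close> and \<open>U\<close> (lemma \<open>reduction_rhs_split\<close>).
\<close>

definition reduction_principal_part ::
  "ftns_system \<Rightarrow> (label \<Rightarrow> label \<Rightarrow> complex) \<Rightarrow> (label \<Rightarrow> label \<Rightarrow> complex) \<Rightarrow>
     (3 \<Rightarrow> state) \<Rightarrow> state" where
  "reduction_principal_part S D E P = (\<lambda>X.
     reduction_rhs S D E 0 0 (\<lambda>_. 0) P X - reduction_rhs S D E 0 0 (\<lambda>_. 0) (\<lambda>_ _. 0) X)"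

text \<open>The map \<open>\<A>\<^sub>1\<^sup>p\<close>: the principal part when \<open>\<partial>\<^sub>p u = w\<close> and the other derivatives vanish.\<close>

definition reduction_matrix ::
  "ftns_system \<Rightarrow> (label \<Rightarrow> label \<Rightarrow> complex) \<Rightarrow> (label \<Rightarrow> label \<Rightarrow> complex) \<Rightarrow>
     3 \<Rightarrow> state \<Rightarrow> state" where
  "reduction_matrix S D E p w =
     reduction_principal_part S D E (\<lambda>q. if q = p then w else (\<lambda>_. 0))"

definition reduction_symbol ::
  "ftns_system \<Rightarrow> (label \<Rightarrow> label \<Rightarrow> complex) \<Rightarrow> (label \<Rightarrow> label \<Rightarrow> complex) \<Rightarrow>
     real ^ 3 \<Rightarrow> state \<Rightarrow> state" where
  "reduction_symbol S D E s w =
     (\<lambda>X. \<Sum>p\<in>UNIV. complex_of_real (s $ p) * reduction_matrix S D E p w X)"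

lemma constr_split: "constr U P X = constr (\<lambda>_. 0) P X + constr U (\<lambda>_ _. 0) X"
  by (cases X) (simp add: constr_def symz_def)

lemma constr_bar_zero: "constr_bar (\<lambda>_ _. 0) X = 0"
  by (cases X) (simp add: constr_bar_def symz_def)

lemma constr_zero: "constr (\<lambda>_. 0) (\<lambda>_ _. 0) X = 0"
  by (cases X) (simp add: constr_def symz_def)

lemma constraint_addition_split:
  "constraint_addition S D E U P X =
     constraint_addition S D E (\<lambda>_. 0) P X + constraint_addition S D E U (\<lambda>_ _. 0) X"
  unfolding constraint_addition_def
  by (subst constr_split) (simp add: constr_bar_zero algebra_simps sum.distrib)

lemma reduction_rhs_split:
  "reduction_rhs S D E t x U P X =
     reduction_principal_part S D E P X + reduction_rhs S D E t x U (\<lambda>_ _. 0) X"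
proof -
  have z: "constraint_addition S D E (\<lambda>_. 0) (\<lambda>_ _. 0) X = 0"
    by (simp add: constraint_addition_def constr_zero constr_bar_zero)
  show ?thesis
    using z constraint_addition_split[of S D E U P X]
    by (cases X) (simp add: reduction_principal_part_def reduction_rhs_def symz_def)
qed


subsection \<open>First order symmetric hyperbolicity\<close>

definition first_order_candidate_symmetrizer ::
  "ftns_system \<Rightarrow> (label \<Rightarrow> label \<Rightarrow> complex) \<Rightarrow> bool" where
  "first_order_candidate_symmetrizer S H \<longleftrightarrow>
     symmetric_hermitian (all_labels S) H \<and>
     (\<exists>D E. reduction_parameters S D E \<and>
        (\<forall>s w z. symmetric_state (all_labels S) w \<and> symmetric_state (all_labels S) z \<longrightarrow>
           form (all_labels S) H w (reduction_symbol S D E s z) =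
           cnj (form (all_labels S) H z (reduction_symbol S D E s w))))"

definition first_order_symmetric_hyperbolic :: "ftns_system \<Rightarrow> bool" where
  "first_order_symmetric_hyperbolic S \<longleftrightarrow>
     (\<exists>H. first_order_candidate_symmetrizer S H \<and> positive_definite (all_labels S) H)"

end

theory Submission
  imports Defs
begin

text \<open>
  The restriction of a first order symmetrizer \<open>H\<close> to the top-order variables \<open>d\<^sup>\<mu>\<close> is the required
  symmetrizer.  Indeed, on a state with \<open>(d\<^sup>\<mu>)\<^sub>i = s\<^sub>i \<dots> s\<^sub>i v\<^sup>\<mu>\<close> and vanishing lower order variables the
  principal parts in direction \<open>s\<close> of all auxiliary constraints vanish, so that the symbol of any
  reduction is independent of the reduction parameters and agrees with \<open>\<A>\<^sub>N\<^sup>p s\<^sub>p\<close>.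
\<close>

section \<open>Symmetrization and sums over multi-indices\<close>

text \<open>All rearrangements of \<open>ks\<close> share its multiset, and the
  \<open>fact (length ks)\<close> permutations carry total weight one.\<close>

lemma symz_eq_const:
  assumes "\<And>ls. mset ls = mset ks \<Longrightarrow> f ls = c"
  shows "symz f ks = c"
proof -
  have "(\<Sum>\<pi> | \<pi> permutes {..<length ks}. f (permute_list \<pi> ks))
      = (\<Sum>\<pi> | \<pi> permutes {..<length ks}. c)"
    by (intro sum.cong refl assms) (simp add: mset_permute_list)
  then show ?thesis
    by (simp add: symz_def card_permutations)
qed

lemma symz_add: "symz (\<lambda>ks. f ks + g ks) ks = symz f ks + symz g ks"
  by (simp add: symz_def sum.distrib add_divide_distrib)

lemma symz_cmult: "symz (\<lambda>ks. c * f ks) ks = c * symz f ks"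
  by (simp add: symz_def sum_distrib_left)

lemma symz_zero: "symz (\<lambda>ks. 0) ks = 0"
  by (simp add: symz_def)

lemma symz_sum: "finite F \<Longrightarrow> symz (\<lambda>ks. \<Sum>i\<in>F. f i ks) ks = (\<Sum>i\<in>F. symz (f i) ks)"
  by (induction F rule: finite_induct) (simp_all add: symz_add symz_zero)

lemma finite_mindices [simp]: "finite (mindices k)"
  using finite_lists_length_eq[of "UNIV :: 3 set" k] by (simp add: mindices_def)

lemma sum_mindices_Suc:
  "(\<Sum>ks\<in>mindices (Suc m). f ks) = (\<Sum>i\<in>UNIV. \<Sum>ks\<in>mindices m. f (i # ks))"
proof -
  have "(\<Sum>ks\<in>mindices (Suc m). f ks) = (\<Sum>(i, ks)\<in>UNIV \<times> mindices m. f (i # ks))"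
    by (rule sum.reindex_bij_witness[of _ "\<lambda>(i, ks). i # ks" "\<lambda>ks. (hd ks, tl ks)"])
       (auto simp: mindices_def length_Suc_conv)
  then show ?thesis
    by (simp add: sum.cartesian_product)
qed

lemma sum_mindices_permute_list:
  assumes "\<pi> permutes {..<m}"
  shows "(\<Sum>ks\<in>mindices m. f (permute_list \<pi> ks)) = (\<Sum>ks\<in>mindices m. f ks)"
proof (rule sum.reindex_bij_witness[of _ "permute_list (inv \<pi>)" "permute_list \<pi>"])
  have i: "inv \<pi> permutes {..<m}"
    using assms by (rule permutes_inv)
  fix ks assume "ks \<in> mindices m"
  then have l: "length ks = m"
    by (simp add: mindices_def)
  show "permute_list (inv \<pi>) (permute_list \<pi> ks) = ks"
    using permute_list_compose[of "inv \<pi>" ks \<pi>] i l assms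
    by (simp add: permutes_inv_o)
  show "permute_list \<pi> (permute_list (inv \<pi>) ks) = ks"
    using permute_list_compose[of \<pi> ks "inv \<pi>"] i l assms
    by (simp add: permutes_inv_o)
qed (auto simp: mindices_def)

section \<open>Monomials in \<open>s\<close> and the contraction of the principal matrix\<close>

lemma monom_of_append: "monom_of s (ks @ ls) = monom_of s ks * monom_of s ls"
  by (simp add: monom_of_def)

lemma monom_of_Cons: "monom_of s (k # ks) = complex_of_real (s $ k) * monom_of s ks"
  by (simp add: monom_of_def)

lemma monom_of_mset_cong:
  assumes "mset ks = mset ls"
  shows "monom_of s ks = monom_of s ls"
  using assms by (simp add: monom_of_def flip: prod_mset_prod_list)

lemma cnj_monom_of: "cnj (monom_of s ks) = monom_of s ks"
  by (induction ks) (simp_all add: monom_of_def)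

text \<open>Contraction with the symmetric tensor \<open>monom_of s\<close> sees only the symmetric
  part of \<open>f\<close>: each permutation may be applied to the monomial as well and then
  absorbed by reindexing the sum.\<close>

lemma sum_symz_mult_monom_of:
  "(\<Sum>ks\<in>mindices m. symz f ks * monom_of s ks) = (\<Sum>ks\<in>mindices m. f ks * monom_of s ks)"
proof -
  let ?P = "{\<pi>. \<pi> permutes {..<m}}"
  have "(\<Sum>ks\<in>mindices m. symz f ks * monom_of s ks)
      = (\<Sum>ks\<in>mindices m. \<Sum>\<pi>\<in>?P.
          f (permute_list \<pi> ks) * monom_of s (permute_list \<pi> ks) / fact m)"
    unfolding symz_def sum_divide_distrib sum_distrib_right
    by (intro sum.cong refl)
       (auto simp: mindices_def mset_permute_list intro!: monom_of_mset_cong)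
  also have "\<dots> = (\<Sum>\<pi>\<in>?P. \<Sum>ks\<in>mindices m. f ks * monom_of s ks / fact m)"
    by (subst sum.swap) (intro sum.cong refl sum_mindices_permute_list, simp)
  also have "\<dots> = (\<Sum>ks\<in>mindices m. f ks * monom_of s ks)"
    by (simp add: card_permutations sum_divide_distrib[symmetric])
  finally show ?thesis .
qed

text \<open>Contraction with \<open>s\<close> in all upper indices removes the inner symmetrization,
  and the Kronecker symbols then select one multi-index. Its monomial is unchanged by rearranging
  \<open>is\<close>, so the outer symmetrization has no effect either.\<close>

lemma sum_symz_Delta_monom_of:
  assumes "length is + length ks = Suc m"
  shows "(\<Sum>js\<in>mindices m. \<Sum>p\<in>UNIV.
            symz (\<lambda>is'. symz (\<lambda>js'. Delta (p # js') is' ks) js) is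
              * complex_of_real (s $ p) * monom_of s js)
         = monom_of s is * monom_of s ks"
proof -
  \<comment> \<open>Proved for every rearrangement \<open>ls\<close> of \<open>is\<close>, with a
    value independent of \<open>ls\<close>, as \<open>symz_eq_const\<close> requires for the outer
    symmetrization.\<close>
  have inner: "(\<Sum>js\<in>mindices m. \<Sum>p\<in>UNIV.
            symz (\<lambda>js'. Delta (p # js') ls ks) js * complex_of_real (s $ p) * monom_of s js)
         = monom_of s is * monom_of s ks" if "mset ls = mset is" for ls
  proof -
    have len: "length ls = length is"
      using that by (rule mset_eq_length)
    have "(\<Sum>js\<in>mindices m. \<Sum>p\<in>UNIV.
            symz (\<lambda>js'. Delta (p # js') ls ks) js * complex_of_real (s $ p) * monom_of s js)
        = (\<Sum>p\<in>UNIV. complex_of_real (s $ p) *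
            (\<Sum>js\<in>mindices m. symz (\<lambda>js'. Delta (p # js') ls ks) js * monom_of s js))"
      by (subst sum.swap) (simp add: sum_distrib_left mult_ac)
    \<comment> \<open>With the symmetrization over \<open>js\<close> gone, \<open>p # js\<close>
      becomes a single multi-index of length \<open>Suc m\<close>.\<close>
    also have "\<dots> = (\<Sum>js\<in>mindices (Suc m). Delta js ls ks * monom_of s js)"
      unfolding sum_symz_mult_monom_of
      by (simp add: sum_mindices_Suc monom_of_Cons sum_distrib_left mult_ac)
    also have "\<dots> = (\<Sum>js\<in>mindices (Suc m). if js = ls @ ks then monom_of s js else 0)"
      by (intro sum.cong) (auto simp: Delta_def)
    also have "\<dots> = monom_of s (ls @ ks)"
      using assms len by (subst sum.delta[OF finite_mindices]) (simp add: mindices_def)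
    also have "\<dots> = monom_of s is * monom_of s ks"
      using monom_of_mset_cong[OF that] by (simp add: monom_of_append)
    finally show ?thesis .
  qed
  have "(\<Sum>js\<in>mindices m. \<Sum>p\<in>UNIV.
            symz (\<lambda>is'. symz (\<lambda>js'. Delta (p # js') is' ks) js) is
              * complex_of_real (s $ p) * monom_of s js)
      = symz (\<lambda>is'. \<Sum>js\<in>mindices m. \<Sum>p\<in>UNIV. (complex_of_real (s $ p) * monom_of s js) *
            symz (\<lambda>js'. Delta (p # js') is' ks) js) is"
    by (simp add: symz_sum symz_cmult mult_ac)
  also have "\<dots> = monom_of s is * monom_of s ks"
    by (rule symz_eq_const) (use inner in \<open>simp add: mult_ac\<close>)
  finally show ?thesis .
qed

text \<open>Evaluates the factor to the right of \<open>H\<close> in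
  \<open>contracted_matrix\<close>, in the same closed form that
  \<open>reduction_symbol_plane_wave_top\<close> obtains for the symbol of a reduction.\<close>

lemma sum_principal_matrix_monom_of:
  assumes "(\<mu>, is, a) \<in> top_labels S" and "\<nu> < ft_order S"
  shows "(\<Sum>js\<in>mindices (ft_order S - \<nu> - 1). \<Sum>p\<in>UNIV.
            principal_matrix S p (\<mu>, is, a) (\<nu>, js, b) * complex_of_real (s $ p) * monom_of s js)
         = (if \<nu> \<le> \<mu> + 1 then
             (\<Sum>ks\<in>mindices (\<mu> + 1 - \<nu>). ft_A S \<mu> \<nu> ks a b * monom_of s (is @ ks)) else 0)"
proof (cases "\<nu> \<le> \<mu> + 1")
  case True
  let ?D = "\<lambda>p js ks. symz (\<lambda>is'. symz (\<lambda>js'. Delta (p # js') is' ks) js) is"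
  let ?J = "mindices (ft_order S - \<nu> - 1)"
  have "(\<Sum>js\<in>?J. \<Sum>p\<in>UNIV.
            principal_matrix S p (\<mu>, is, a) (\<nu>, js, b) * complex_of_real (s $ p) * monom_of s js)
      = (\<Sum>js\<in>?J. \<Sum>p\<in>UNIV. \<Sum>ks\<in>mindices (\<mu> + 1 - \<nu>).
            ft_A S \<mu> \<nu> ks a b * (?D p js ks * complex_of_real (s $ p) * monom_of s js))"
    using True by (simp add: principal_matrix_def sum_distrib_right sum_distrib_left mult_ac)
  also have "\<dots> = (\<Sum>js\<in>?J. \<Sum>ks\<in>mindices (\<mu> + 1 - \<nu>). \<Sum>p\<in>UNIV.
            ft_A S \<mu> \<nu> ks a b * (?D p js ks * complex_of_real (s $ p) * monom_of s js))"
    by (intro sum.cong refl sum.swap)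
  also have "\<dots> = (\<Sum>ks\<in>mindices (\<mu> + 1 - \<nu>). \<Sum>js\<in>?J. \<Sum>p\<in>UNIV.
            ft_A S \<mu> \<nu> ks a b * (?D p js ks * complex_of_real (s $ p) * monom_of s js))"
    by (rule sum.swap)
  also have "\<dots> = (\<Sum>ks\<in>mindices (\<mu> + 1 - \<nu>). ft_A S \<mu> \<nu> ks a b *
            (\<Sum>js\<in>?J. \<Sum>p\<in>UNIV. ?D p js ks * complex_of_real (s $ p) * monom_of s js))"
    by (simp only: sum_distrib_left)
  also have "\<dots> = (\<Sum>ks\<in>mindices (\<mu> + 1 - \<nu>). ft_A S \<mu> \<nu> ks a b * monom_of s (is @ ks))"
  proof (rule sum.cong[OF refl])
    fix ks assume "ks \<in> mindices (\<mu> + 1 - \<nu>)"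
    \<comment> \<open>With \<open>N = ft_order S\<close>, the lengths \<open>N - \<mu> - 1\<close>
      and \<open>\<mu> + 1 - \<nu>\<close> add up to \<open>N - \<nu>\<close>;
      \<open>\<nu> < N\<close> keeps the natural subtraction exact.\<close>
    then have "length is + length ks = Suc (ft_order S - \<nu> - 1)"
      using assms True by (auto simp: top_labels_def mindices_def)
    from sum_symz_Delta_monom_of[OF this, of s]
    show "ft_A S \<mu> \<nu> ks a b *
            (\<Sum>js\<in>?J. \<Sum>p\<in>UNIV. ?D p js ks * complex_of_real (s $ p) * monom_of s js)
        = ft_A S \<mu> \<nu> ks a b * monom_of s (is @ ks)"
      by (simp add: monom_of_append)
  qed
  finally show ?thesis
    using True by simp
qed (simp add: principal_matrix_def)

section \<open>Linearity of the principal part in the gradient\<close>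

lemma constr_add:
  "constr (\<lambda>_. 0) (\<lambda>q x. P q x + Q q x) X = constr (\<lambda>_. 0) P X + constr (\<lambda>_. 0) Q X"
  by (cases X) (simp add: constr_def symz_add)

lemma constr_bar_add:
  "constr_bar (\<lambda>q x. P q x + Q q x) X = constr_bar P X + constr_bar Q X"
  by (cases X) (simp add: constr_bar_def symz_add)

lemma constr_cmult:
  "constr (\<lambda>_. 0) (\<lambda>q x. c * P q x) X = c * constr (\<lambda>_. 0) P X"
  by (cases X) (simp add: constr_def symz_cmult)

lemma constr_bar_cmult: "constr_bar (\<lambda>q x. c * P q x) X = c * constr_bar P X"
  by (cases X) (simp add: constr_bar_def symz_cmult algebra_simps)

lemma constraint_addition_add:
  "constraint_addition S D E (\<lambda>_. 0) (\<lambda>q x. P q x + Q q x) X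
     = constraint_addition S D E (\<lambda>_. 0) P X + constraint_addition S D E (\<lambda>_. 0) Q X"
  unfolding constraint_addition_def constr_add constr_bar_add
  by (simp add: algebra_simps sum.distrib)

lemma constraint_addition_cmult:
  "constraint_addition S D E (\<lambda>_. 0) (\<lambda>q x. c * P q x) X
     = c * constraint_addition S D E (\<lambda>_. 0) P X"
  unfolding constraint_addition_def constr_cmult constr_bar_cmult
  by (simp add: algebra_simps sum_distrib_left)

text \<open>At \<open>U = 0\<close> the undifferentiated terms vanish, and the source cancels in the
  difference that defines the principal part.\<close>

lemma reduction_principal_part_eq:
  "reduction_principal_part S D E P (\<mu>, is, a) =
     (if length is < ft_order S - \<mu> - 1 then 0
      else if \<mu> < ft_order S - 1 then
        (\<Sum>\<nu>=0..\<mu> + 1. \<Sum>js\<in>mindices (\<mu> + 1 - \<nu>). \<Sum>b<ft_dim S \<nu>.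
           ft_A S \<mu> \<nu> js a b * symz (\<lambda>ls. P (hd ls) (\<nu>, tl ls, b)) (is @ js))
      else
        (\<Sum>\<nu>=0..\<mu>. \<Sum>j\<in>UNIV. \<Sum>js\<in>mindices (\<mu> - \<nu>). \<Sum>b<ft_dim S \<nu>.
           ft_A S \<mu> \<nu> (j # js) a b * P j (\<nu>, js, b)))
     + constraint_addition S D E (\<lambda>_. 0) P (\<mu>, is, a)"
proof -
  have "constraint_addition S D E (\<lambda>_. 0) (\<lambda>_ _. 0) (\<mu>, is, a) = 0"
    by (simp add: constraint_addition_def constr_zero constr_bar_zero)
  then show ?thesis
    by (simp add: reduction_principal_part_def reduction_rhs_def symz_zero)
qed

lemma reduction_principal_part_add:
  "reduction_principal_part S D E (\<lambda>q x. P q x + Q q x) X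
     = reduction_principal_part S D E P X + reduction_principal_part S D E Q X"
  by (cases X)
     (simp add: reduction_principal_part_eq constraint_addition_add symz_add algebra_simps sum.distrib)

lemma reduction_principal_part_cmult:
  "reduction_principal_part S D E (\<lambda>q x. c * P q x) X = c * reduction_principal_part S D E P X"
  by (cases X)
     (simp add: reduction_principal_part_eq constraint_addition_cmult symz_cmult algebra_simps
       sum_distrib_left)

lemma reduction_principal_part_sum:
  assumes "finite F"
  shows "reduction_principal_part S D E (\<lambda>q x. \<Sum>p\<in>F. P p q x) X
     = (\<Sum>p\<in>F. reduction_principal_part S D E (P p) X)"
  using assms
proof (induction F rule: finite_induct)
  case empty
  show ?case
    using reduction_principal_part_cmult[of S D E 0 "\<lambda>_ _. 0" X] by simp
qed (simp add: reduction_principal_part_add)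

text \<open>By linearity the three directional maps combine into one evaluation of the principal
  part, at the rank-one gradient \<open>s \<otimes> w\<close>.\<close>

lemma reduction_symbol_eq:
  "reduction_symbol S D E s w X
     = reduction_principal_part S D E (\<lambda>q x. complex_of_real (s $ q) * w x) X"
proof -
  have eq: "(\<lambda>q x. complex_of_real (s $ q) * w x)
      = (\<lambda>q x. \<Sum>p\<in>UNIV. complex_of_real (s $ p) * (if q = p then w else (\<lambda>_. 0)) x)"
  proof (intro ext)
    fix q x
    have "(\<Sum>p\<in>UNIV. complex_of_real (s $ p) * (if q = p then w else (\<lambda>_. 0)) x)
        = (\<Sum>p\<in>UNIV. if q = p then complex_of_real (s $ p) * w x else 0)"
      by (intro sum.cong) auto
    then show "complex_of_real (s $ q) * w x
        = (\<Sum>p\<in>UNIV. complex_of_real (s $ p) * (if q = p then w else (\<lambda>_. 0)) x)"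
      by simp
  qed
  show ?thesis
    unfolding eq reduction_principal_part_sum[OF finite] reduction_principal_part_cmult
    by (simp add: reduction_symbol_def reduction_matrix_def)
qed

section \<open>The symbol of a reduction on plane wave states\<close>

text \<open>This is the column \<open>(\<nu>, b)\<close> of the diagonal matrix of monomials
  \<open>S^N\<close>, extended by zero to the lower order variables of the reduction.\<close>

definition plane_wave :: "ftns_system \<Rightarrow> real ^ 3 \<Rightarrow> nat \<Rightarrow> nat \<Rightarrow> state" where
  "plane_wave S s \<nu> b = (\<lambda>(\<nu>', ks, b').
     if \<nu>' = \<nu> \<and> b' = b \<and> length ks = ft_order S - \<nu> - 1 then monom_of s ks else 0)"

lemma symmetric_state_plane_wave: "symmetric_state L (plane_wave S s \<nu> b)"
  unfolding symmetric_state_def plane_wave_def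
  by (auto dest: mset_eq_length intro: monom_of_mset_cong)

lemma mult_plane_wave:
  assumes "ls \<noteq> []"
  shows "complex_of_real (s $ hd ls) * plane_wave S s \<nu> b (\<nu>', tl ls, b') =
     (if \<nu>' = \<nu> \<and> b' = b \<and> length ls = Suc (ft_order S - \<nu> - 1) then monom_of s ls else 0)"
  using assms by (cases ls) (auto simp: plane_wave_def monom_of_Cons)

text \<open>Multiplication by the derivative direction only lengthens the monomial, which is already
  totally symmetric. Comparison with \<open>mult_plane_wave\<close> shows that symmetrizing the
  gradient changes nothing.\<close>

lemma symz_plane_wave:
  assumes "ks \<noteq> []"
  shows "symz (\<lambda>ls. complex_of_real (s $ hd ls) * plane_wave S s \<nu> b (\<nu>', tl ls, b')) ks =
     (if \<nu>' = \<nu> \<and> b' = b \<and> length ks = Suc (ft_order S - \<nu> - 1) then monom_of s ks else 0)"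
proof (rule symz_eq_const)
  fix ls assume m: "mset ls = mset ks"
  then have "ls \<noteq> []"
    using assms by auto
  then show "complex_of_real (s $ hd ls) * plane_wave S s \<nu> b (\<nu>', tl ls, b') =
     (if \<nu>' = \<nu> \<and> b' = b \<and> length ks = Suc (ft_order S - \<nu> - 1) then monom_of s ks else 0)"
    using mset_eq_length[OF m] monom_of_mset_cong[OF m] by (simp add: mult_plane_wave)
qed

text \<open>The unbarred constraints differentiate only lower order variables, which are zero here.
  The barred ones measure the failure of the gradient to be symmetric, and it is symmetric. Hence
  the reduction parameters drop out of the symbol.\<close>

lemma constraint_addition_plane_wave:
  "constraint_addition S D E (\<lambda>_. 0)
     (\<lambda>q x. complex_of_real (s $ q) * plane_wave S s \<nu> b x) X = 0"
proof -
  let ?P = "\<lambda>q x. complex_of_real (s $ q) * plane_wave S s \<nu> b x"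
  have c: "constr (\<lambda>_. 0) ?P (\<nu>', ks, b') = 0"
    if "ks \<in> mindices \<sigma>" "\<sigma> \<in> {1..ft_order S - \<nu>' - 1}" for \<nu>' ks b' \<sigma>
  proof -
    \<comment> \<open>The differentiated gradient is nonzero only at length
      \<open>Suc (ft_order S - \<nu>' - 1)\<close>, one above the largest admissible
      \<open>\<sigma>\<close>.\<close>
    have "ks \<noteq> []" "length ks \<noteq> Suc (ft_order S - \<nu>' - 1)"
      using that by (auto simp: mindices_def)
    then show ?thesis
      by (auto simp: constr_def symz_plane_wave)
  qed
  have "constr_bar ?P (\<nu>', ks, b') = 0" if "ks \<in> mindices (\<sigma> + 1)" for \<nu>' ks b' \<sigma>
  proof -
    have "ks \<noteq> []"
      using that by (auto simp: mindices_def)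
    then show ?thesis
      by (simp add: constr_bar_def symz_plane_wave mult_plane_wave)
  qed
  with c show ?thesis
    unfolding constraint_addition_def by (intro sum.neutral ballI) simp
qed

text \<open>The equations for lower order variables contain derivatives only through the added
  constraints.\<close>

lemma reduction_symbol_plane_wave_lower:
  assumes "(\<mu>, is, a) \<in> all_labels S - top_labels S"
  shows "reduction_symbol S D E s (plane_wave S s \<nu> b) (\<mu>, is, a) = 0"
  using assms unfolding reduction_symbol_eq reduction_principal_part_eq constraint_addition_plane_wave
  by (auto simp: all_labels_def top_labels_def)

text \<open>Only the \<open>ft_A\<close> terms survive, and symmetrized or not, the derivative of
  the plane wave is a monomial. The cases separate the equations for \<open>d^\<mu>\<close> from the
  one for \<open>v^(N-1)\<close>, which has an explicit derivative index.\<close>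

lemma reduction_symbol_plane_wave_top:
  assumes "(\<mu>, is, a) \<in> top_labels S" and "\<nu> < ft_order S" and "b < ft_dim S \<nu>"
  shows "reduction_symbol S D E s (plane_wave S s \<nu> b) (\<mu>, is, a)
     = (if \<nu> \<le> \<mu> + 1 then
         (\<Sum>ks\<in>mindices (\<mu> + 1 - \<nu>). ft_A S \<mu> \<nu> ks a b * monom_of s (is @ ks)) else 0)"
proof -
  let ?P = "\<lambda>q x. complex_of_real (s $ q) * plane_wave S s \<nu> b x"
  have len: "length is = ft_order S - \<mu> - 1" and mu: "\<mu> < ft_order S"
    using assms by (auto simp: top_labels_def)
  have pick: "(\<Sum>b'<ft_dim S \<nu>'. f b' * (if \<nu>' = \<nu> \<and> b' = b then g else 0))
      = (if \<nu>' = \<nu> then f b * g else 0)" for \<nu>' and f :: "nat \<Rightarrow> complex" and g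
    using assms(3) by (auto simp: if_distrib cong: if_cong)
  show ?thesis
  proof (cases "\<mu> < ft_order S - 1")
    case True
    have "(\<Sum>b'<ft_dim S \<nu>'. ft_A S \<mu> \<nu>' ks a b' *
             symz (\<lambda>ls. ?P (hd ls) (\<nu>', tl ls, b')) (is @ ks))
        = (if \<nu>' = \<nu> then ft_A S \<mu> \<nu> ks a b * monom_of s (is @ ks) else 0)"
      if "\<nu>' \<in> {0..\<mu> + 1}" "ks \<in> mindices (\<mu> + 1 - \<nu>')" for \<nu>' ks
    proof -
      \<comment> \<open>This is exactly the length at which the gradient of block
        \<open>\<nu>'\<close> is nonzero, so only the condition
        \<open>\<nu>' = \<nu> \<and> b' = b\<close> remains.\<close>
      have l: "length (is @ ks) = ft_order S - \<nu>'"
        using that len True by (auto simp: mindices_def)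
      have "is @ ks \<noteq> []"
        using len True by auto
      then have "symz (\<lambda>ls. ?P (hd ls) (\<nu>', tl ls, b')) (is @ ks)
          = (if \<nu>' = \<nu> \<and> b' = b then monom_of s (is @ ks) else 0)" for b'
        using l assms(2) by (auto simp: symz_plane_wave)
      then show ?thesis
        by (auto simp: pick)
    qed
    then have "(\<Sum>\<nu>'=0..\<mu> + 1. \<Sum>ks\<in>mindices (\<mu> + 1 - \<nu>'). \<Sum>b'<ft_dim S \<nu>'.
           ft_A S \<mu> \<nu>' ks a b' * symz (\<lambda>ls. ?P (hd ls) (\<nu>', tl ls, b')) (is @ ks))
        = (\<Sum>\<nu>'=0..\<mu> + 1. if \<nu>' = \<nu> then
             (\<Sum>ks\<in>mindices (\<mu> + 1 - \<nu>). ft_A S \<mu> \<nu> ks a b * monom_of s (is @ ks)) else 0)"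
      by (intro sum.cong refl) auto
    then show ?thesis
      unfolding reduction_symbol_eq reduction_principal_part_eq constraint_addition_plane_wave
      using True len by simp
  next
    case False
    have "is = []" and N: "ft_order S = Suc \<mu>"
      using False mu len by auto
    have "(\<Sum>b'<ft_dim S \<nu>'. ft_A S \<mu> \<nu>' (j # js) a b' * ?P j (\<nu>', js, b'))
        = (if \<nu>' = \<nu> then ft_A S \<mu> \<nu> (j # js) a b * monom_of s (j # js) else 0)"
      if "\<nu>' \<in> {0..\<mu>}" "js \<in> mindices (\<mu> - \<nu>')" for \<nu>' j js
    proof -
      have "?P j (\<nu>', js, b') = (if \<nu>' = \<nu> \<and> b' = b then monom_of s (j # js) else 0)" for b'
        using that N by (auto simp: plane_wave_def mindices_def monom_of_Cons)
      then show ?thesis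
        by (auto simp: pick)
    qed
    then have "(\<Sum>\<nu>'=0..\<mu>. \<Sum>j\<in>UNIV. \<Sum>js\<in>mindices (\<mu> - \<nu>'). \<Sum>b'<ft_dim S \<nu>'.
           ft_A S \<mu> \<nu>' (j # js) a b' * ?P j (\<nu>', js, b'))
        = (\<Sum>\<nu>'=0..\<mu>. if \<nu>' = \<nu> then
             (\<Sum>j\<in>UNIV. \<Sum>js\<in>mindices (\<mu> - \<nu>).
                ft_A S \<mu> \<nu> (j # js) a b * monom_of s (j # js)) else 0)"
      by (intro sum.cong refl) auto
    \<comment> \<open>Here \<open>\<mu> = N - 1\<close>, so \<open>\<nu> \<le> \<mu>\<close> lies in
      the summation range; \<open>j # js\<close> is merged into one multi-index.\<close>
    also have "\<dots> = (\<Sum>ks\<in>mindices (Suc (\<mu> - \<nu>)). ft_A S \<mu> \<nu> ks a b * monom_of s ks)"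
      using assms(2) N by (simp add: sum_mindices_Suc)
    also have "Suc (\<mu> - \<nu>) = \<mu> + 1 - \<nu>"
      using assms(2) N by auto
    finally show ?thesis
      unfolding reduction_symbol_eq reduction_principal_part_eq constraint_addition_plane_wave
      using False \<open>is = []\<close> assms(2) N by simp
  qed
qed

section \<open>Restriction of the symmetrizer to the top order variables\<close>

lemma top_labels_subset: "top_labels S \<subseteq> all_labels S"
  by (auto simp: top_labels_def all_labels_def)

lemma finite_all_labels: "finite (all_labels S)"
proof (rule finite_subset)
  show "all_labels S \<subseteq>
      (SIGMA \<mu>:{..<ft_order S}. {is. set is \<subseteq> UNIV \<and> length is \<le> ft_order S} \<times> {..<ft_dim S \<mu>})"
    by (auto simp: all_labels_def)
  show "finite (SIGMA \<mu>:{..<ft_order S}.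
      {is :: mindex. set is \<subseteq> UNIV \<and> length is \<le> ft_order S} \<times> {..<ft_dim S \<mu>})"
    by (intro finite_SigmaI finite_cartesian_product finite_lists_length_le) auto
qed

lemma form_plane_wave:
  assumes "\<mu> < ft_order S" and "a < ft_dim S \<mu>"
  shows "form (all_labels S) H (plane_wave S s \<mu> a) z
     = (\<Sum>is\<in>mindices (ft_order S - \<mu> - 1). \<Sum>y\<in>all_labels S.
          monom_of s is * H (\<mu>, is, a) y * z y)"
proof -
  let ?I = "mindices (ft_order S - \<mu> - 1)"
  let ?F = "\<lambda>x. \<Sum>y\<in>all_labels S. cnj (plane_wave S s \<mu> a x) * H x y * z y"
  have "form (all_labels S) H (plane_wave S s \<mu> a) z = sum ?F ((\<lambda>is. (\<mu>, is, a)) ` ?I)"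
    unfolding form_def
    by (rule sum.mono_neutral_right[OF finite_all_labels])
       (use assms in \<open>auto simp: all_labels_def mindices_def plane_wave_def image_iff\<close>)
  also have "\<dots> = (\<Sum>is\<in>?I. ?F (\<mu>, is, a))"
    by (subst sum.reindex) (auto simp: inj_on_def)
  also have "\<dots> = (\<Sum>is\<in>?I. \<Sum>y\<in>all_labels S. monom_of s is * H (\<mu>, is, a) y * z y)"
    by (intro sum.cong refl) (simp add: plane_wave_def mindices_def cnj_monom_of)
  finally show ?thesis .
qed

text \<open>Both principal parts act identically on plane waves in the top components, and the
  symbol of the reduction has no lower order components there. Conservation of the first order form
  thus passes to the contracted matrix entry by entry.\<close>

lemma contracted_matrix_eq_form:
  assumes "\<mu> < ft_order S" and "a < ft_dim S \<mu>" and "\<nu> < ft_order S" and "b < ft_dim S \<nu>"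
  shows "contracted_matrix S H s (\<mu>, a) (\<nu>, b)
     = form (all_labels S) H (plane_wave S s \<mu> a) (reduction_symbol S D E s (plane_wave S s \<nu> b))"
proof -
  let ?I = "mindices (ft_order S - \<mu> - 1)" and ?J = "mindices (ft_order S - \<nu> - 1)"
  let ?z = "reduction_symbol S D E s (plane_wave S s \<nu> b)"
  have z: "(\<Sum>js\<in>?J. \<Sum>p\<in>UNIV.
        principal_matrix S p y (\<nu>, js, b) * complex_of_real (s $ p) * monom_of s js) = ?z y"
    if "y \<in> top_labels S" for y
    using that assms
    by (cases y) (simp only: sum_principal_matrix_monom_of reduction_symbol_plane_wave_top)
  have "contracted_matrix S H s (\<mu>, a) (\<nu>, b)
      = (\<Sum>is\<in>?I. \<Sum>y\<in>top_labels S. \<Sum>js\<in>?J. \<Sum>p\<in>UNIV.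
          monom_of s is * H (\<mu>, is, a) y * principal_matrix S p y (\<nu>, js, b)
           * complex_of_real (s $ p) * monom_of s js)"
    unfolding contracted_matrix_def prod.case by (intro sum.cong refl sum.swap)
  also have "\<dots> = (\<Sum>is\<in>?I. \<Sum>y\<in>top_labels S. monom_of s is * H (\<mu>, is, a) y *
      (\<Sum>js\<in>?J. \<Sum>p\<in>UNIV.
        principal_matrix S p y (\<nu>, js, b) * complex_of_real (s $ p) * monom_of s js))"
    by (simp only: sum_distrib_left mult.assoc)
  also have "\<dots> = (\<Sum>is\<in>?I. \<Sum>y\<in>top_labels S. monom_of s is * H (\<mu>, is, a) y * ?z y)"
    by (intro sum.cong refl) (simp only: z)
  \<comment> \<open>Blocks of \<open>H\<close> coupling top to lower order variables contribute
    nothing, because \<open>?z\<close> vanishes on the added labels.\<close>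
  also have "\<dots> = (\<Sum>is\<in>?I. \<Sum>y\<in>all_labels S. monom_of s is * H (\<mu>, is, a) y * ?z y)"
    by (intro sum.cong refl sum.mono_neutral_left finite_all_labels top_labels_subset ballI)
       (use reduction_symbol_plane_wave_lower in force)
  finally show ?thesis
    using assms by (simp add: form_plane_wave)
qed

lemma symmetric_hermitian_subset:
  assumes "symmetric_hermitian L H" and "K \<subseteq> L"
  shows "symmetric_hermitian K H"
  using assms unfolding symmetric_hermitian_def hermitian_on_def symmetric_state_def by blast

lemma positive_definite_top_labels:
  assumes "positive_definite (all_labels S) H"
  shows "positive_definite (top_labels S) H"
  unfolding positive_definite_def
proof (intro allI impI, elim conjE)
  fix w assume sym: "symmetric_state (top_labels S) w" and nz: "\<exists>x\<in>top_labels S. w x \<noteq> 0"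
  \<comment> \<open>Extension by zero stays symmetric, since membership in \<open>top_labels\<close>
    depends on a multi-index only through its length.\<close>
  define z where "z x = (if x \<in> top_labels S then w x else 0)" for x
  have "symmetric_state (all_labels S) z"
    unfolding symmetric_state_def
  proof (intro allI impI, elim conjE)
    fix \<mu> a and "is" js :: mindex assume m: "mset is = mset js"
    have "(\<mu>, is, a) \<in> top_labels S \<longleftrightarrow> (\<mu>, js, a) \<in> top_labels S"
      using mset_eq_length[OF m] by (simp add: top_labels_def)
    moreover have "w (\<mu>, is, a) = w (\<mu>, js, a)" if "(\<mu>, is, a) \<in> top_labels S"
      using sym that m unfolding symmetric_state_def by blast
    ultimately show "z (\<mu>, is, a) = z (\<mu>, js, a)"
      by (simp add: z_def)
  qed
  moreover have "\<exists>x\<in>all_labels S. z x \<noteq> 0"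
    using nz top_labels_subset by (force simp: z_def)
  ultimately have "Re (form (all_labels S) H z z) > 0"
    using assms by (simp add: positive_definite_def)
  also have "form (all_labels S) H z z = (\<Sum>x\<in>top_labels S. \<Sum>y\<in>all_labels S. cnj (z x) * H x y * z y)"
    unfolding form_def
    by (rule sum.mono_neutral_right[OF finite_all_labels top_labels_subset]) (simp add: z_def)
  also have "\<dots> = (\<Sum>x\<in>top_labels S. \<Sum>y\<in>top_labels S. cnj (z x) * H x y * z y)"
    by (intro sum.cong refl sum.mono_neutral_right finite_all_labels top_labels_subset)
       (simp add: z_def)
  also have "\<dots> = form (top_labels S) H w w"
    unfolding form_def by (intro sum.cong refl) (simp add: z_def)
  finally show "Re (form (top_labels S) H w w) > 0" .
qed

theorem mainTheorem2:
  fixes S :: ftns_system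
  assumes "ft_order S \<ge> 1"
    and "first_order_symmetric_hyperbolic S"
  shows "ftns_symmetric_hyperbolic S"
proof -
  obtain H D E where H: "symmetric_hermitian (all_labels S) H" "positive_definite (all_labels S) H"
    and herm: "\<And>s w z. symmetric_state (all_labels S) w \<Longrightarrow> symmetric_state (all_labels S) z \<Longrightarrow>
           form (all_labels S) H w (reduction_symbol S D E s z) =
           cnj (form (all_labels S) H z (reduction_symbol S D E s w))"
    using assms(2)
    unfolding first_order_symmetric_hyperbolic_def first_order_candidate_symmetrizer_def by blast
  \<comment> \<open>Each pair of entries is an instance of \<open>herm\<close> for two plane waves
    with the same \<open>s\<close>.\<close>
  have "hermitian_on {(\<mu>, a). \<mu> < ft_order S \<and> a < ft_dim S \<mu>} (contracted_matrix S H s)" for s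
    unfolding hermitian_on_def
    by (auto simp: contracted_matrix_eq_form[where D = D and E = E]
        intro!: herm symmetric_state_plane_wave)
  with H show ?thesis
    unfolding ftns_symmetric_hyperbolic_def ftns_candidate_symmetrizer_def
    using symmetric_hermitian_subset[OF _ top_labels_subset] positive_definite_top_labels by blast
qed

end
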